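(* Let $r \geq 3$, $k \geq t\ge 1$ and $n\geq\frac{rk-t}{r-1}+t+1$ be integers, and let $V$ be an $n$-dimensional vector space over $\mathbb{F}_q$. If $\mathcal{F} \subseteq { V \brack k}$ is an $r$-wise $t$-intersecting family, then $$|\mathcal{F}| \leq { n-t \brack k-t}.$$ Equality holds if and only if $\mathcal{F}=\{ F \in {V \brack k} : T \subseteq F\}$ for some $T \in {V \brack t}$.
   Context: $q$ is a prime power and $\mathbb{F}_q$ is the finite field with $q$ elements. ${V\brack k}$ denotes the set of all $k$-dimensional subspaces of $V$. For integers, ${a\brack b}=\prod_{i=0}^{b-1}\frac{q^{a-i}-1}{q^{b-i}-1}$ is the Gaussian binomial coefficient, with ${a\brack 0}=1$ and ${a\brack c}=0$ for $c<0$. A family $\mathcal{F}\subseteq{V\brack k}$ is $r$-wise $t$-intersecting if $\dim(F_1\cap\cdots\cap F_r)\geq t$ for every choice of (not necessarily distinct) $F_1,\ldots,F_r\in\mathcal{F}$. *)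

theory Defs
  imports Complex_Main "HOL-Library.Cardinality"
begin

definition gauss_binomial :: "nat \<Rightarrow> int \<Rightarrow> int \<Rightarrow> real" where
  "gauss_binomial q a b =
     (if b < 0 then 0
      else (\<Prod>i\<in>{0..b - 1}. (real q powi (a - i) - 1) / (real q powi (b - i) - 1)))"

context vector_space
begin

(* For k > 0 the condition dim W = k already forces W to be finite-dimensional; the value
   dim W = 0 is also assigned by the library to infinite-dimensional W. *)
definition grassmannian :: "nat \<Rightarrow> 'b set set" where
  "grassmannian k = {W. subspace W \<and> dim W = k}"

definition wise_intersecting :: "nat \<Rightarrow> nat \<Rightarrow> 'b set set \<Rightarrow> bool" where
  "wise_intersecting r t \<F> \<longleftrightarrow>
     (\<forall>F :: nat \<Rightarrow> 'b set. (\<forall>i\<in>{1..r}. F i \<in> \<F>) \<longrightarrow> t \<le> dim (\<Inter>i\<in>{1..r}. F i))"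

end

end

theory Submission
  imports Defs
begin

text \<open>
Write \<open>q\<close> for the size of the field and \<open>n = k + t + c + 1\<close>; the hypothesis on \<open>n\<close> says
\<open>k - t \<le> (r - 1) c\<close>. The \<open>k\<close>-spaces above a given \<open>s\<close>-space are counted by the Gaussian
binomial \<open>N s = [n - s, k - s]\<close>, and \<open>N t > q ^ (b (n - k)) N (t + b)\<close> for \<open>b \<ge> 1\<close>. If all members
of the family contain a common \<open>t\<close>-space, then the family lies in the set of all \<open>k\<close>-spaces above
that space, and both claims are immediate. So everything rests on a strict bound: a family without
a common \<open>t\<close>-space has fewer than \<open>N t\<close> members. Suppose it has at least \<open>N t\<close>.

Small intersections. Every member \<open>F\<close> belongs to some \<open>r - 1\<close> members whose intersection \<open>D\<close> has
dimension \<open>t + a\<close> with \<open>(r - 1) a < k - t\<close>, hence \<open>a < c\<close>. These members are chosen greedily, each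
one making the current intersection as small as possible. If the excess over \<open>t\<close> did not fall at
least as fast as on the straight line from \<open>k - t\<close> down to \<open>0\<close>, then at some step every member would
meet a space of dimension \<open>t + a' + e\<close> in dimension at least \<open>t + a'\<close>, where \<open>e \<le> a'\<close> and \<open>e \<le> c\<close>.
Such a space has so few subspaces of dimension \<open>t + a'\<close> that the family would have fewer than \<open>N t\<close>
members (\<open>card_less_of_small_drop\<close>, \<open>small_intersection_exists\<close>).

Branching. Let \<open>M\<close> be a space of least dimension \<open>t + b\<close> that meets every member in dimension at
least \<open>t\<close>. As there is no common \<open>t\<close>-space, \<open>b \<ge> 1\<close>. Each member contains one of the at most
\<open>q ^ ((t + 1) b)\<close> \<open>t\<close>-spaces in \<open>M\<close>. A space \<open>S\<close> of dimension less than \<open>t + b\<close> meets some member \<open>F\<close>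
in dimension less than \<open>t\<close>, whereas every member meets the small intersection \<open>D\<close> inside \<open>F\<close> in
dimension at least \<open>t\<close>, by the \<open>r\<close>-wise condition. So members above \<open>S\<close> contain new vectors of \<open>D\<close>,
and passing from \<open>S\<close> to a space of one more dimension costs a factor of at most \<open>q ^ c\<close>
(\<open>card_branching_le\<close>). After \<open>b\<close> steps the family has at most
\<open>q ^ ((t + 1) b) * q ^ (c b) * N (t + b) = q ^ (b (n - k)) N (t + b) < N t\<close> members, a contradiction
(\<open>card_less_of_no_common\<close>).
\<close>

section \<open>Gaussian binomial coefficients\<close>

lemma gauss_binomial_0: "gauss_binomial q a 0 = 1"
  by (simp add: gauss_binomial_def)

lemma gauss_binomial_Suc_Suc:
  "gauss_binomial q (int (Suc m)) (int (Suc j)) =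
     (real q ^ Suc m - 1) / (real q ^ Suc j - 1) * gauss_binomial q (int m) (int j)"
proof -
  let ?f = "\<lambda>i. (real q powi (int (Suc m) - i) - 1) / (real q powi (int (Suc j) - i) - 1)"
  have *: "{0..int (Suc j) - 1} = insert 0 ((\<lambda>i. i + 1) ` {0..int j - 1})"
    by auto
  have "prod ?f ((\<lambda>i. i + 1) ` {0..int j - 1}) = (\<Prod>i\<in>{0..int j - 1}. ?f (i + 1))"
    by (subst prod.reindex) (auto simp: inj_on_def)
  also have "\<dots> = gauss_binomial q (int m) (int j)"
    by (simp add: gauss_binomial_def)
  finally show ?thesis
    unfolding gauss_binomial_def[of q "int (Suc m)"] *
    by (subst prod.insert) (auto simp del: of_nat_Suc power_Suc simp: power_int_of_nat)
qed

lemma gauss_binomial_pos: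
  assumes "q \<ge> 2" "j \<le> m"
  shows "gauss_binomial q (int m) (int j) > 0"
  using assms(2)
proof (induction j arbitrary: m)
  case (Suc j)
  then obtain m' where m: "m = Suc m'" "j \<le> m'"
    by (cases m) auto
  have "real q ^ Suc i > 1" for i
    using assms(1) by (intro one_less_power) auto
  then show ?case
    unfolding m(1) gauss_binomial_Suc_Suc using Suc.IH[OF m(2)] by simp
qed (simp add: gauss_binomial_0)

text \<open>
Raising \<open>d\<close> by one shifts the numerators of the defining product by one place, so all but the
two extreme ones cancel.
\<close>
lemma gauss_binomial_Suc_upper:
  assumes "q \<ge> 2"
  shows "gauss_binomial q (int (Suc d + u)) (int u) * (real q ^ Suc d - 1) =
         gauss_binomial q (int (d + u)) (int u) * (real q ^ Suc (d + u) - 1)"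
proof (induction u)
  case (Suc u)
  have *: "Suc d + Suc u = Suc (Suc d + u)" "d + Suc u = Suc (d + u)" by auto
  have rearrange: "A / B * G * D = D' / B * G' * A" if "G * D = G' * D'" for A B D D' G G' :: real
    using that by (metis mult.assoc mult.commute times_divide_eq_left)
  show ?case
    unfolding * gauss_binomial_Suc_Suc using rearrange[OF Suc.IH] by (simp only: add_Suc)
qed (simp add: gauss_binomial_0)

text \<open>
Raising \<open>d\<close> to \<open>d + 1\<close> multiplies the coefficient by \<open>(q ^ (d + u + 1) - 1) / (q ^ (d + 1) - 1)\<close>,
which is at most \<open>q ^ (u + 1)\<close> because \<open>q \<ge> 2\<close>. The true order is \<open>q ^ (u d)\<close>; the loss of \<open>q ^ d\<close>
is what the last summand \<open>1\<close> in the hypothesis on the ambient dimension pays for.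
\<close>
lemma gauss_binomial_le_power:
  assumes "q \<ge> 2"
  shows "gauss_binomial q (int (d + u)) (int u) \<le> real q ^ (Suc u * d)"
proof (induction d)
  case 0
  have "gauss_binomial q (int u) (int u) = 1"
  proof (induction u)
    case (Suc u)
    have "real q ^ Suc u > 1"
      using assms by (intro one_less_power) auto
    then show ?case unfolding gauss_binomial_Suc_Suc using Suc by simp
  qed (simp add: gauss_binomial_0)
  then show ?case by simp
next
  case (Suc d)
  have gt: "real q ^ Suc d > 1"
    using assms by (intro one_less_power) auto
  have "real q ^ Suc d * real q ^ u \<ge> real q ^ Suc u"
    using assms by (subst power_add[symmetric], intro power_increasing) auto
  moreover have "2 * (real q ^ Suc d * real q ^ u) \<le> real q * (real q ^ Suc d * real q ^ u)"
    using assms by (intro mult_right_mono) auto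
  ultimately have "real q ^ Suc (d + u) - 1 \<le> real q ^ Suc u * (real q ^ Suc d - 1)"
    by (simp add: algebra_simps power_add)
  then have "gauss_binomial q (int (d + u)) (int u) * (real q ^ Suc (d + u) - 1)
      \<le> real q ^ (Suc u * d) * (real q ^ Suc u * (real q ^ Suc d - 1))"
    using Suc.IH gauss_binomial_pos[OF assms, of u "d + u"] assms
    by (intro mult_mono) (auto simp: one_le_power simp del: power_Suc of_nat_add)
  then have "gauss_binomial q (int (Suc d + u)) (int u) * (real q ^ Suc d - 1)
      \<le> real q ^ (Suc u * Suc d) * (real q ^ Suc d - 1)"
    unfolding gauss_binomial_Suc_upper[OF assms]
    by (simp only: power_add[symmetric] mult.assoc[symmetric] mult_Suc_right add.commute)
  then show ?case using gt by simp
qed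

lemma gauss_binomial_Suc_Suc_gt:
  assumes "q \<ge> 2" "j < m"
  shows "real q ^ (m - j) * gauss_binomial q (int m) (int j)
           < gauss_binomial q (int (Suc m)) (int (Suc j))"
proof -
  have "real q ^ Suc j > 1" and "real q ^ (m - j) > 1"
    using assms by (auto intro!: one_less_power simp del: power_Suc)
  moreover have "real q ^ (m - j) * real q ^ Suc j = real q ^ Suc m"
    using assms by (simp flip: power_add)
  ultimately have "real q ^ (m - j) < (real q ^ Suc m - 1) / (real q ^ Suc j - 1)"
    by (simp add: less_divide_eq right_diff_distrib del: power_Suc)
  then show ?thesis unfolding gauss_binomial_Suc_Suc
    using gauss_binomial_pos[OF assms(1), of j m] assms by (intro mult_strict_right_mono) auto
qed

lemma gauss_binomial_diagonal_growth:
  assumes "q \<ge> 2" "j < m" "b \<ge> 1"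
  shows "real q ^ (b * (m - j)) * gauss_binomial q (int m) (int j)
           < gauss_binomial q (int (b + m)) (int (b + j))"
  using assms(3)
proof (induction b rule: dec_induct)
  case base
  show ?case using gauss_binomial_Suc_Suc_gt[OF assms(1,2)] by simp
next
  case (step b)
  have "real q ^ (m - j) * (real q ^ (b * (m - j)) * gauss_binomial q (int m) (int j))
      \<le> real q ^ (m - j) * gauss_binomial q (int (b + m)) (int (b + j))"
    using step.IH by (intro mult_left_mono) auto
  also have "\<dots> < gauss_binomial q (int (Suc (b + m))) (int (Suc (b + j)))"
    using gauss_binomial_Suc_Suc_gt[OF assms(1), of "b + j" "b + m"] assms(2) by simp
  finally show ?case by (simp add: power_add mult_ac)
qed

section \<open>Counting subspaces over a finite field\<close>

lemma sum_card_containing: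
  assumes "finite X" "finite \<G>"
  shows "(\<Sum>x\<in>X. card {G \<in> \<G>. x \<in> G}) = (\<Sum>G\<in>\<G>. card (G \<inter> X))"
proof -
  have "(\<Sum>x\<in>X. card {G \<in> \<G>. x \<in> G}) = (\<Sum>x\<in>X. \<Sum>G\<in>{G \<in> \<G>. x \<in> G}. 1)"
    by simp
  also have "\<dots> = (\<Sum>G\<in>\<G>. \<Sum>x\<in>{x \<in> X. x \<in> G}. 1)"
    using assms by (rule sum.swap_restrict)
  finally show ?thesis by (simp add: Int_def conj_commute)
qed

locale finite_field_vector_space = finite_dimensional_vector_space scale Basis
  for scale :: "'a::{field,finite} \<Rightarrow> 'b::ab_group_add \<Rightarrow> 'b" (infixr "*s" 75) and Basis
begin

lemma card_field_ge_2: "CARD('a) \<ge> 2"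
proof -
  have "card {0, 1 :: 'a} \<le> CARD('a)" by (intro card_mono) auto
  then show ?thesis by simp
qed

text \<open>
Adjoining an independent vector multiplies the size of the span by the size of the field, since
\<open>(c, y) \<mapsto> c *s x + y\<close> is injective on pairs of a scalar and an old vector.
\<close>
lemma card_span_independent:
  assumes "independent B"
  shows "finite (span B) \<and> card (span B) = CARD('a) ^ card B"
  using finiteI_independent[OF assms] assms
proof (induction B)
  case (insert x B)
  then have indep: "independent B" and x: "x \<notin> span B"
    by (auto simp: independent_insert)
  let ?f = "\<lambda>(c, y). c *s x + y"
  have inj: "inj_on ?f (UNIV \<times> span B)"
  proof (rule inj_onI, clarify)
    fix c d y z assume yz: "y \<in> span B" "z \<in> span B" and eq: "c *s x + y = d *s x + z"
    then have "(c - d) *s x = z - y"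
      unfolding scale_left_diff_distrib by (metis add_diff_cancel_left add_diff_eq diff_add_cancel diff_diff_eq2)
    then have "(c - d) *s x \<in> span B"
      using yz by (simp add: span_diff)
    then have "c = d"
      using x span_scale[of "(c - d) *s x" B "inverse (c - d)"] by (cases "c = d") auto
    then show "c = d \<and> y = z" using eq by simp
  qed
  have "span (insert x B) = ?f ` (UNIV \<times> span B)"
  proof (intro equalityI subsetI)
    fix v assume "v \<in> span (insert x B)"
    then obtain c where "v - c *s x \<in> span B" by (auto simp: span_insert)
    then show "v \<in> ?f ` (UNIV \<times> span B)"
      by (intro image_eqI[of _ _ "(c, v - c *s x)"]) auto
  next
    fix v assume "v \<in> ?f ` (UNIV \<times> span B)"
    then obtain c y where "y \<in> span B" "v = c *s x + y" by auto
    then show "v \<in> span (insert x B)" by (auto simp: span_insert intro!: exI[of _ c])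
  qed
  moreover have "finite (UNIV \<times> span B :: ('a \<times> 'b) set)" using insert.IH[OF indep] by simp
  ultimately show ?case
    using insert card_image[OF inj] insert.IH[OF indep] by (simp add: card_cartesian_product)
qed simp

lemma finite_vectors: "finite (A :: 'b set)"
  using card_span_independent[OF independent_Basis] finite_subset[of A UNIV]
  by (simp add: span_Basis)

lemma finite_vector_sets: "finite (\<A> :: 'b set set)"
  using finite_vectors[of UNIV] finite_subset[of \<A> "Pow UNIV"] by (auto simp: Finite_Set.finite_set)

lemma card_subspace:
  assumes "subspace S"
  shows "card S = CARD('a) ^ dim S"
proof -
  obtain B where "B \<subseteq> S" "independent B" "S \<subseteq> span B" "card B = dim S"
    by (rule basis_exists)
  then show ?thesis
    using card_span_independent[of B] span_subspace[of B S] assms by simp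
qed

lemma dim_span_insert:
  assumes "subspace S" "x \<notin> S"
  shows "dim (span (insert x S)) = Suc (dim S)"
proof -
  have "x \<notin> span S" using assms span_eq_iff[of S] by metis
  then show ?thesis by (simp add: dim_insert)
qed

lemma span_insert_subset_iff:
  assumes "subspace F"
  shows "span (insert x S) \<subseteq> F \<longleftrightarrow> x \<in> F \<and> S \<subseteq> F"
  using assms span_minimal[of "insert x S" F] span_superset[of "insert x S"] by blast

lemma subspace_of_dim_exists:
  assumes "d \<le> dim S"
  obtains T where "subspace T" "T \<subseteq> span S" "dim T = d"
proof -
  obtain B where B: "B \<subseteq> S" "independent B" "S \<subseteq> span B" "card B = dim S"
    by (rule basis_exists)
  obtain C where C: "C \<subseteq> B" "card C = d"
    using assms B(4) by (metis obtain_subset_with_card_n)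
  have "independent C" using B(2) C(1) by (rule independent_mono)
  then show ?thesis
    using that[of "span C"] C B(1) span_mono[of C S] dim_span_eq_card_independent[of C] by auto
qed

text \<open>
Pairs of a subspace \<open>F\<close> between \<open>S\<close> and \<open>U\<close> and a vector of \<open>F\<close> outside \<open>S\<close> are counted in two
ways. Each such vector enlarges \<open>S\<close> by one dimension, so an induction on the codimension of \<open>S\<close>
in \<open>F\<close> reproduces the recursion for Gaussian binomials without using quotient spaces.
\<close>
lemma card_subspaces_between:
  assumes "subspace S" "subspace U" "S \<subseteq> U" "dim S + j \<le> dim U"
  shows "real (card {F. subspace F \<and> S \<subseteq> F \<and> F \<subseteq> U \<and> dim F = dim S + j})
    = gauss_binomial CARD('a) (int (dim U - dim S)) (int j)"
  using assms
proof (induction j arbitrary: S)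
  case 0
  have "{F. subspace F \<and> S \<subseteq> F \<and> F \<subseteq> U \<and> dim F = dim S + 0} = {S}"
    using 0 subspace_dim_equal by fastforce
  then show ?case by (simp add: gauss_binomial_0)
next
  case (Suc j)
  define q where "q = CARD('a)"
  have q: "q \<ge> 2" using card_field_ge_2 by (simp add: q_def)
  define m where "m = dim U - Suc (dim S)"
  have m: "dim U - dim S = Suc m" and dimU: "dim U = Suc m + dim S"
    using Suc.prems(4) by (auto simp: m_def)
  define \<G> where "\<G> = {F. subspace F \<and> S \<subseteq> F \<and> F \<subseteq> U \<and> dim F = dim S + Suc j}"
  have point: "real (card {G \<in> \<G>. x \<in> G}) = gauss_binomial q (int m) (int j)" if "x \<in> U - S" for x
  proof -
    let ?S = "span (insert x S)"
    have dimS: "dim ?S = Suc (dim S)"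
      using dim_span_insert[OF Suc.prems(1)] that by blast
    have "{G \<in> \<G>. x \<in> G} = {F. subspace F \<and> ?S \<subseteq> F \<and> F \<subseteq> U \<and> dim F = dim ?S + j}"
      unfolding \<G>_def dimS by (auto simp: span_insert_subset_iff cong: conj_cong)
    moreover have "?S \<subseteq> U" using Suc.prems(2,3) that by (simp add: span_insert_subset_iff)
    ultimately show ?thesis
      using Suc.IH[of ?S] Suc.prems(2,4) dimU unfolding q_def dimS by simp
  qed
  have member: "real (card (G \<inter> (U - S))) = real q ^ dim S * (real q ^ Suc j - 1)" if "G \<in> \<G>" for G
  proof -
    have G: "subspace G" "S \<subseteq> G" "G \<subseteq> U" "dim G = dim S + Suc j" using that by (auto simp: \<G>_def)
    have "G \<inter> (U - S) = G - S" using G by auto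
    moreover have "card S \<le> card G" using G finite_vectors by (intro card_mono) auto
    ultimately show ?thesis
      using G Suc.prems(1) finite_vectors
      by (simp add: card_Diff_subset card_subspace of_nat_diff power_add q_def algebra_simps)
  qed
  have "real (card U) - real (card S) = real (card (U - S))"
    using Suc.prems(3) finite_vectors by (simp add: card_Diff_subset of_nat_diff card_mono)
  then have compl: "real (card (U - S)) = real q ^ dim S * (real q ^ Suc m - 1)"
    using Suc.prems(1,2) dimU by (simp add: card_subspace q_def power_add algebra_simps)
  have "(\<Sum>x\<in>U - S. real (card {G \<in> \<G>. x \<in> G})) = (\<Sum>G\<in>\<G>. real (card (G \<inter> (U - S))))"
    using sum_card_containing[of "U - S" \<G>, OF finite_vectors finite_vector_sets]
    by (simp flip: of_nat_sum)
  then have count: "real q ^ dim S * (real q ^ Suc m - 1) * gauss_binomial q (int m) (int j)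
      = real (card \<G>) * (real q ^ dim S * (real q ^ Suc j - 1))"
    by (simp add: point member compl del: power_Suc)
  have "real q ^ Suc j > 1"
    using q by (intro one_less_power) auto
  then have "real q ^ Suc j - 1 \<noteq> 0" by linarith
  moreover have "real q ^ dim S \<noteq> 0" using q by simp
  moreover have "x = A / C * g" if "p * A * g = x * (p * C)" "C \<noteq> 0" "p \<noteq> 0" for x A C g p :: real
    using that by (simp add: field_simps)
  ultimately have "real (card \<G>)
      = (real q ^ Suc m - 1) / (real q ^ Suc j - 1) * gauss_binomial q (int m) (int j)"
    using count by presburger
  then show ?case
    unfolding m gauss_binomial_Suc_Suc \<G>_def q_def .
qed

lemma card_grassmannian_containing:
  assumes "subspace S" "dim S \<le> k" "k \<le> dimension"
  shows "real (card {F \<in> grassmannian k. S \<subseteq> F})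
    = gauss_binomial CARD('a) (int (dimension - dim S)) (int (k - dim S))"
proof -
  have "{F \<in> grassmannian k. S \<subseteq> F}
      = {F. subspace F \<and> S \<subseteq> F \<and> F \<subseteq> UNIV \<and> dim F = dim S + (k - dim S)}"
    using assms(2) by (auto simp: grassmannian_def)
  then show ?thesis
    using card_subspaces_between[OF assms(1) subspace_UNIV, of "k - dim S"] assms
    by (simp add: dimension_def)
qed

section \<open>Bounds for families that meet a fixed subspace\<close>

text \<open>
Every member lies above some \<open>u\<close>-dimensional subspace of \<open>D\<close>, and there are few of these.
\<close>
lemma card_meeting_le:
  assumes D: "subspace D" and u: "u \<le> dim D"
    and sub: "\<And>G. G \<in> \<G> \<Longrightarrow> subspace G" and meet: "\<And>G. G \<in> \<G> \<Longrightarrow> u \<le> dim (G \<inter> D)"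
    and bound: "\<And>U. subspace U \<Longrightarrow> dim U = u \<Longrightarrow> real (card {G \<in> \<G>. U \<subseteq> G}) \<le> B"
  shows "real (card \<G>) \<le> real CARD('a) ^ (Suc u * (dim D - u)) * B"
proof -
  define \<U> where "\<U> = {U. subspace U \<and> {0} \<subseteq> U \<and> U \<subseteq> D \<and> dim U = dim {0} + u}"
  have "real (card \<U>) = gauss_binomial CARD('a) (int (dim D)) (int u)"
    unfolding \<U>_def using card_subspaces_between[of "{0}" D u] D u by (simp add: subspace_0)
  also have "\<dots> \<le> real CARD('a) ^ (Suc u * (dim D - u))"
    using gauss_binomial_le_power[OF card_field_ge_2, of "dim D - u" u] u by simp
  finally have card_U: "real (card \<U>) \<le> real CARD('a) ^ (Suc u * (dim D - u))" .
  have "\<exists>U\<in>\<U>. U \<subseteq> G" if G: "G \<in> \<G>" for G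
  proof -
    obtain U where "subspace U" "U \<subseteq> span (G \<inter> D)" "dim U = u"
      using subspace_of_dim_exists[of u "G \<inter> D"] meet[OF G] by blast
    moreover have "span (G \<inter> D) = G \<inter> D"
      using sub[OF G] D by (simp add: subspace_inter)
    ultimately show ?thesis by (auto simp: \<U>_def subspace_0)
  qed
  then have "\<G> \<subseteq> (\<Union>U\<in>\<U>. {G \<in> \<G>. U \<subseteq> G})" by blast
  then have "card \<G> \<le> card (\<Union>U\<in>\<U>. {G \<in> \<G>. U \<subseteq> G})"
    by (intro card_mono finite_vector_sets)
  also have "\<dots> \<le> (\<Sum>U\<in>\<U>. card {G \<in> \<G>. U \<subseteq> G})"
    by (intro card_UN_le finite_vector_sets)
  finally have "real (card \<G>) \<le> (\<Sum>U\<in>\<U>. real (card {G \<in> \<G>. U \<subseteq> G}))"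
    by (simp flip: of_nat_sum)
  also have "\<dots> \<le> (\<Sum>U\<in>\<U>. B)"
    using bound by (intro sum_mono) (auto simp: \<U>_def)
  also have "\<dots> \<le> real CARD('a) ^ (Suc u * (dim D - u)) * B"
  proof -
    obtain U where "subspace U" "dim U = u"
      using subspace_of_dim_exists[OF u] by blast
    then have "B \<ge> 0" using bound[of U] by linarith
    then show ?thesis using card_U by (simp add: mult_right_mono)
  qed
  finally show ?thesis .
qed

text \<open>
A member meets \<open>D\<close> in at least \<open>q ^ t\<close> vectors, of which at most \<open>q ^ (t - 1)\<close> lie in \<open>S\<close>; hence at
least \<open>q ^ (t - 1)\<close> are new. Each vector of \<open>D\<close> outside \<open>S\<close> lies in at most \<open>B\<close> members, because
together with \<open>S\<close> it spans a space of the next dimension. Counting pairs of a member and a new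
vector gives at most \<open>q ^ (t + a) * B / q ^ (t - 1)\<close> members.
\<close>
lemma card_branching_le:
  assumes S: "subspace S" and D: "subspace D" "dim D \<le> t + a" and SD: "dim (S \<inter> D) < t"
    and sub: "\<And>G. G \<in> \<G> \<Longrightarrow> subspace G" and meet: "\<And>G. G \<in> \<G> \<Longrightarrow> t \<le> dim (G \<inter> D)"
    and SG: "\<And>G. G \<in> \<G> \<Longrightarrow> S \<subseteq> G"
    and B: "B \<ge> 0"
    and bound: "\<And>S'. subspace S' \<Longrightarrow> dim S' = Suc (dim S) \<Longrightarrow> real (card {G \<in> \<G>. S' \<subseteq> G}) \<le> B"
  shows "real (card \<G>) \<le> real CARD('a) ^ Suc a * B"
proof -
  define q where "q = CARD('a)"
  have q: "q \<ge> 2" using card_field_ge_2 by (simp add: q_def)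
  obtain t' where t: "t = Suc t'" using SD by (cases t) auto
  have new: "real q ^ t' \<le> real (card (G \<inter> (D - S)))" if "G \<in> \<G>" for G
  proof -
    have "card (S \<inter> D) \<le> q ^ t'"
      using S D SD q t by (simp add: card_subspace subspace_inter q_def power_increasing)
    moreover have "2 * q ^ t' \<le> q ^ t"
      using q by (simp add: t)
    moreover have "q ^ t \<le> card (G \<inter> D)"
      using sub[OF that] D meet[OF that] q
      by (simp add: card_subspace subspace_inter q_def power_increasing)
    moreover have "card (G \<inter> D) \<le> card ((S \<inter> D) \<union> (G \<inter> (D - S)))"
      using finite_vectors by (intro card_mono) auto
    moreover have "\<dots> \<le> card (S \<inter> D) + card (G \<inter> (D - S))"
      by (rule card_Un_le)
    ultimately have "q ^ t' \<le> card (G \<inter> (D - S))" by linarith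
    then show ?thesis by (simp flip: of_nat_power)
  qed
  have point: "real (card {G \<in> \<G>. x \<in> G}) \<le> B" if "x \<in> D - S" for x
  proof -
    have "x \<in> G \<longleftrightarrow> span (insert x S) \<subseteq> G" if "G \<in> \<G>" for G
      using span_insert_subset_iff[OF sub[OF that]] SG[OF that] by blast
    then have "{G \<in> \<G>. x \<in> G} = {G \<in> \<G>. span (insert x S) \<subseteq> G}"
      by (intro Collect_cong conj_cong refl)
    then show ?thesis
      using bound[of "span (insert x S)"] dim_span_insert[OF S] that by auto
  qed
  have "real (card \<G>) * real q ^ t' = (\<Sum>G\<in>\<G>. real q ^ t')" by simp
  also have "\<dots> \<le> (\<Sum>G\<in>\<G>. real (card (G \<inter> (D - S))))"
    by (intro sum_mono new)
  also have "\<dots> = (\<Sum>x\<in>D - S. real (card {G \<in> \<G>. x \<in> G}))"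
    using sum_card_containing[of "D - S" \<G>, OF finite_vectors finite_vector_sets]
    by (simp flip: of_nat_sum)
  also have "\<dots> \<le> (\<Sum>x\<in>D - S. B)"
    by (intro sum_mono point)
  also have "\<dots> \<le> real (card D) * B"
    using B finite_vectors by (simp add: card_mono mult_right_mono)
  also have "\<dots> \<le> real q ^ (t + a) * B"
    using D B q by (intro mult_right_mono) (simp_all add: card_subspace q_def power_increasing)
  also have "\<dots> = (real q ^ Suc a * B) * real q ^ t'"
    by (simp add: t power_add mult_ac)
  finally have "real (card \<G>) * real q ^ t' \<le> (real q ^ Suc a * B) * real q ^ t'" .
  moreover have "real q ^ t' > 0" using q by simp
  ultimately have "real (card \<G>) \<le> real q ^ Suc a * B"
    by (rule mult_right_le_imp_le)
  then show ?thesis by (simp only: q_def)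
qed

end

section \<open>Families without a common t-dimensional subspace\<close>

text \<open>
The parameter \<open>c\<close> is the slack in the ambient dimension; \<open>kc\<close> is the lower bound on that dimension,
cleared of its denominator.
\<close>
locale nontrivial_wise_intersecting_family = finite_field_vector_space scale Basis
  for scale :: "'a::{field,finite} \<Rightarrow> 'b::ab_group_add \<Rightarrow> 'b" (infixr "*s" 75) and Basis +
  fixes r k t c :: nat and \<F> :: "'b set set"
  assumes r: "3 \<le> r" and tk: "t \<le> k"
    and dimension_eq: "dimension = k + t + Suc c" and kc: "k - t \<le> (r - 1) * c"
    and family: "\<F> \<subseteq> grassmannian k" and wise: "wise_intersecting r t \<F>"
    and no_common: "\<not> (\<exists>T \<in> grassmannian t. \<forall>F \<in> \<F>. T \<subseteq> F)"
begin

text \<open>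
The number of \<open>k\<close>-dimensional subspaces above a given \<open>s\<close>-dimensional one. The field size is an
argument because the field does not occur in the type of any other argument.
\<close>
abbreviation num_above :: "nat \<Rightarrow> nat \<Rightarrow> real" where
  "num_above q s \<equiv> gauss_binomial q (int (dimension - s)) (int (k - s))"

lemma member: "F \<in> \<F> \<Longrightarrow> subspace F" "F \<in> \<F> \<Longrightarrow> dim F = k"
  using family by (auto simp: grassmannian_def)

lemma card_members_containing_le:
  assumes "subspace S" "dim S \<le> k"
  shows "real (card {F \<in> \<F>. S \<subseteq> F}) \<le> num_above CARD('a) (dim S)"
proof -
  have "card {F \<in> \<F>. S \<subseteq> F} \<le> card {F \<in> grassmannian k. S \<subseteq> F}"
    using family by (intro card_mono finite_vector_sets) auto
  then show ?thesis
    using card_grassmannian_containing[OF assms] dimension_eq by simp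
qed

lemma num_above_nonneg: "0 \<le> num_above CARD('a) s"
  by (rule less_imp_le, rule gauss_binomial_pos[OF card_field_ge_2])
    (simp add: dimension_eq diff_le_mono)

lemma num_above_decay:
  assumes "b \<ge> 1" "t + b \<le> k"
  shows "real CARD('a) ^ (b * (t + Suc c)) * num_above CARD('a) (t + b) < num_above CARD('a) t"
proof -
  have shift: "dimension - (t + b) - (k - (t + b)) = t + Suc c"
    "b + (dimension - (t + b)) = dimension - t" "b + (k - (t + b)) = k - t"
    and less: "k - (t + b) < dimension - (t + b)"
    using assms dimension_eq by auto
  show ?thesis
    using gauss_binomial_diagonal_growth[OF card_field_ge_2 less assms(1)] unfolding shift .
qed

text \<open>
Repeating one of the \<open>j\<close> members fills them up to \<open>r\<close> without changing the intersection.
\<close>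
lemma dim_Inter_members_ge:
  assumes "1 \<le> j" "j \<le> r" "\<forall>i\<in>{1..j}. Fs i \<in> \<F>"
  shows "t \<le> dim (\<Inter>i\<in>{1..j}. Fs i)"
proof -
  let ?Fs = "\<lambda>i. if i \<le> j then Fs i else Fs 1"
  have "(\<Inter>i\<in>{1..r}. ?Fs i) = (\<Inter>i\<in>{1..j}. Fs i)"
  proof (intro equalityI INT_greatest)
    fix i assume "i \<in> {1..j}"
    then show "(\<Inter>i\<in>{1..r}. ?Fs i) \<subseteq> Fs i"
      using assms(2) INT_lower[of i "{1..r}" ?Fs] by simp
  next
    fix i assume "i \<in> {1..r}"
    then show "(\<Inter>i\<in>{1..j}. Fs i) \<subseteq> ?Fs i"
      using assms(1) INT_lower[of i "{1..j}" Fs] INT_lower[of 1 "{1..j}" Fs] by simp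
  qed
  moreover have "\<forall>i\<in>{1..r}. ?Fs i \<in> \<F>" using assms by auto
  then have "t \<le> dim (\<Inter>i\<in>{1..r}. ?Fs i)"
    by (rule mp[OF wise[unfolded wise_intersecting_def, THEN spec]])
  ultimately show ?thesis by simp
qed

lemma family_nonempty: "\<F> \<noteq> {}"
proof
  assume "\<F> = {}"
  have "t \<le> dim UNIV" using dimension_eq by (simp add: dimension_def)
  then obtain T where "subspace T" "dim T = t" using subspace_of_dim_exists by blast
  then show False using no_common \<open>\<F> = {}\<close> by (auto simp: grassmannian_def)
qed

text \<open>
A \<open>t\<close>-space that every member meets in dimension \<open>t\<close> is contained in every member.
\<close>
lemma no_t_space_met_fully:
  assumes "subspace T" "dim T = t" "\<And>G. G \<in> \<F> \<Longrightarrow> t \<le> dim (G \<inter> T)"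
  shows False
proof -
  have "T \<subseteq> G" if "G \<in> \<F>" for G
    using subspace_dim_equal[of "G \<inter> T" T] assms(1,2) assms(3)[OF that] member(1)[OF that]
    by (auto simp: subspace_inter)
  moreover have "T \<in> grassmannian t" using assms(1,2) by (simp add: grassmannian_def)
  ultimately show False using no_common by blast
qed

lemma t_less_k: "t < k"
proof (rule ccontr)
  assume "\<not> t < k"
  then have "k = t" using tk by simp
  obtain F where F: "F \<in> \<F>" using family_nonempty by blast
  have "t \<le> dim (G \<inter> F)" if "G \<in> \<F>" for G
  proof -
    have "{1..2::nat} = {1, 2}" by auto
    then show ?thesis
      using dim_Inter_members_ge[of 2 "\<lambda>i. if i = 1 then G else F"] F that r by (simp add: Int_commute)
  qed
  then show False using no_t_space_met_fully[of F] member[OF F] \<open>k = t\<close> by blast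
qed

text \<open>
There are at most \<open>q ^ ((t + a + 1) e)\<close> subspaces of dimension \<open>t + a\<close> in \<open>D\<close>, while requiring \<open>a\<close>
dimensions beyond \<open>t\<close> saves a factor of more than \<open>q ^ (a (t + 1 + c))\<close>. The bounds \<open>e \<le> a\<close> and
\<open>e \<le> c\<close> make the saving at least as large as the number of choices.
\<close>
lemma card_less_of_small_drop:
  assumes D: "subspace D" "dim D = t + a + e"
    and meet: "\<And>G. G \<in> \<F> \<Longrightarrow> t + a \<le> dim (G \<inter> D)"
    and a: "1 \<le> a" "t + a \<le> k" and e: "e \<le> a" "e \<le> c"
  shows "real (card \<F>) < num_above CARD('a) t"
proof -
  have "real (card \<F>) \<le> real CARD('a) ^ (Suc (t + a) * (dim D - (t + a))) * num_above CARD('a) (t + a)"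
  proof (rule card_meeting_le)
    show "subspace D" "t + a \<le> dim D" using D by auto
    show "subspace G" "t + a \<le> dim (G \<inter> D)" if "G \<in> \<F>" for G
      using member(1) meet that by auto
    show "real (card {F \<in> \<F>. U \<subseteq> F}) \<le> num_above CARD('a) (t + a)"
      if "subspace U" "dim U = t + a" for U
      using card_members_containing_le[of U] that a(2) by simp
  qed
  also have "\<dots> \<le> real CARD('a) ^ (a * (t + Suc c)) * num_above CARD('a) (t + a)"
  proof (intro mult_right_mono power_increasing)
    have "Suc t * e + a * e \<le> Suc t * a + a * c"
      using e by (intro add_mono mult_left_mono) auto
    then show "Suc (t + a) * (dim D - (t + a)) \<le> a * (t + Suc c)"
      using D(2) by (simp add: algebra_simps)
    show "num_above CARD('a) (t + a) \<ge> 0" by (rule num_above_nonneg)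
  qed (use card_field_ge_2 in simp)
  also have "\<dots> < num_above CARD('a) t" using num_above_decay a by simp
  finally show ?thesis .
qed

text \<open>
The greedy choice of \<open>r - 1\<close> members starting with \<open>F\<close>. After \<open>j\<close> of them the excess over \<open>t\<close> is
at most \<open>(r - j) (k - t) / (r - 1)\<close>, strictly less from the second member on. A first step that
violates this has a drop \<open>e\<close> of at most \<open>(k - t) / (r - 1)\<close> and still leaves an excess of at least
\<open>(k - t) / (r - 1)\<close>, so \<open>card_less_of_small_drop\<close> rules it out. Strictness at \<open>j = r - 1\<close>, which
needs \<open>r \<ge> 3\<close>, makes the final excess less than \<open>c\<close>.
\<close>
lemma small_intersection_exists:
  assumes large: "num_above CARD('a) t \<le> real (card \<F>)" and F: "F \<in> \<F>"
  obtains D where "subspace D" "D \<subseteq> F" "dim D < t + c" "\<And>G. G \<in> \<F> \<Longrightarrow> t \<le> dim (G \<inter> D)"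
proof -
  define R where "R = r - 1"
  have R: "2 \<le> R" "r = Suc R" and kRc: "k - t \<le> R * c" using r kc by (auto simp: R_def)
  have greedy: "\<exists>Fs a. (\<forall>i\<in>{1..j}. Fs i \<in> \<F>) \<and> Fs 1 = F \<and> dim (\<Inter>i\<in>{1..j}. Fs i) = t + a \<and>
      R * a \<le> (Suc R - j) * (k - t) \<and> (2 \<le> j \<longrightarrow> R * a < (Suc R - j) * (k - t))"
    if "1 \<le> j" "j \<le> R" for j
    using that
  proof (induction j rule: dec_induct)
    case base
    show ?case
      using F member(2)[OF F] tk by (intro exI[of _ "\<lambda>_. F"] exI[of _ "k - t"]) simp
  next
    case (step j)
    then obtain Fs a where Fs: "\<forall>i\<in>{1..j}. Fs i \<in> \<F>" "Fs 1 = F"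
      and a: "dim (\<Inter>i\<in>{1..j}. Fs i) = t + a" "R * a \<le> (Suc R - j) * (k - t)" by auto
    define D where "D = (\<Inter>i\<in>{1..j}. Fs i)"
    have D: "subspace D" "dim D = t + a"
      using Fs(1) a(1) member(1) unfolding D_def by (auto intro!: subspace_Int)
    have extend: "(\<Inter>i\<in>{1..Suc j}. (Fs(Suc j := G)) i) = G \<inter> D" for G
      unfolding D_def using step.hyps by (auto simp: atLeastAtMostSuc_conv)
    have members: "\<forall>i\<in>{1..Suc j}. (Fs(Suc j := G)) i \<in> \<F>" if "G \<in> \<F>" for G
      using Fs(1) that by (auto simp: atLeastAtMostSuc_conv)
    obtain G where G: "G \<in> \<F>" and least: "\<And>G'. G' \<in> \<F> \<Longrightarrow> dim (G \<inter> D) \<le> dim (G' \<inter> D)"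
      using ex_has_least_nat[of "\<lambda>G. G \<in> \<F>" F "\<lambda>G. dim (G \<inter> D)"] F by blast
    have "t \<le> dim (G \<inter> D)"
      using dim_Inter_members_ge[of "Suc j" "Fs(Suc j := G)"] members[OF G] extend step.prems R(2)
      by simp
    then obtain a' where a': "dim (G \<inter> D) = t + a'" using le_Suc_ex by blast
    have "a' \<le> a" using dim_subset[of "G \<inter> D" D] D(2) a' by simp
    have "t + a' \<le> k" using dim_subset[of "G \<inter> D" G] member(2)[OF G] a' by simp
    \<comment> \<open>The new excess \<open>a'\<close> lies below the line: otherwise the drop \<open>a - a'\<close> is too small.\<close>
    have "R * a' < (Suc R - Suc j) * (k - t)"
    proof (rule ccontr)
      assume "\<not> ?thesis"
      then have ge: "(R - j) * (k - t) \<le> R * a'" by simp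
      have "1 \<le> R - j" using step.prems by arith
      then have "k - t \<le> (R - j) * (k - t)" using mult_le_mono1[of 1 "R - j" "k - t"] by simp
      then have "k - t \<le> R * a'" using ge by (rule order_trans)
      then have "a' \<ge> 1" using t_less_k by (cases a') auto
      have "(Suc R - j) * (k - t) = (R - j) * (k - t) + (k - t)"
        using step.prems by (simp add: Suc_diff_le)
      then have "R * a - R * a' \<le> k - t"
        using a(2) ge by linarith
      then have "R * (a - a') \<le> k - t" by (simp only: diff_mult_distrib2)
      then have "R * (a - a') \<le> R * a'" "R * (a - a') \<le> R * c"
        using \<open>k - t \<le> R * a'\<close> kRc order_trans by blast+
      then have "a - a' \<le> a'" "a - a' \<le> c" using R(1) by (auto simp only: mult_le_cancel1)
      then have "real (card \<F>) < num_above CARD('a) t"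
        using card_less_of_small_drop[of D a' "a - a'"] D least a' \<open>a' \<le> a\<close> \<open>a' \<ge> 1\<close> \<open>t + a' \<le> k\<close>
        by simp
      then show False using large by simp
    qed
    then show ?case
      using members[OF G] extend[of G] a' Fs(2) step.hyps
      by (intro exI[of _ "Fs(Suc j := G)"] exI[of _ a']) auto
  qed
  obtain Fs a where Fs: "\<forall>i\<in>{1..R}. Fs i \<in> \<F>" "Fs 1 = F"
    and a: "dim (\<Inter>i\<in>{1..R}. Fs i) = t + a" "R * a < (Suc R - R) * (k - t)"
    using greedy[of R] R(1) by auto
  let ?D = "\<Inter>i\<in>{1..R}. Fs i"
  show ?thesis
  proof (rule that[of ?D])
    show "subspace ?D" using Fs(1) member(1) by (auto intro!: subspace_Int)
    show "?D \<subseteq> F" using Fs(2) R(1) by force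
    have "R * a < k - t" using a(2) by simp
    then have "R * a < R * c" using kRc by (rule less_le_trans)
    then show "dim ?D < t + c" using a(1) by simp
    show "t \<le> dim (G \<inter> ?D)" if "G \<in> \<F>" for G
    proof -
      have "(\<Inter>i\<in>{1..Suc R}. (Fs(Suc R := G)) i) = G \<inter> ?D"
        by (auto simp: atLeastAtMostSuc_conv)
      moreover have "\<forall>i\<in>{1..Suc R}. (Fs(Suc R := G)) i \<in> \<F>"
        using Fs(1) that by (auto simp: atLeastAtMostSuc_conv)
      ultimately show ?thesis
        using dim_Inter_members_ge[of "Suc R" "Fs(Suc R := G)"] R(2) by simp
    qed
  qed
qed

text \<open>
The branching argument, started from a space \<open>M\<close> of least dimension among those that meet every
member in dimension at least \<open>t\<close>. Minimality supplies, for each smaller \<open>S\<close>, a member that meets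
\<open>S\<close> in dimension less than \<open>t\<close>, so the branching goes on until dimension \<open>t + b\<close> is reached.
\<close>
lemma card_less_of_no_common:
  "real (card \<F>) < num_above CARD('a) t"
proof (rule ccontr)
  assume "\<not> ?thesis"
  then have large: "num_above CARD('a) t \<le> real (card \<F>)" by simp
  define cover where "cover M \<longleftrightarrow> subspace M \<and> (\<forall>G\<in>\<F>. t \<le> dim (G \<inter> M))" for M
  obtain F0 where F0: "F0 \<in> \<F>" using family_nonempty by blast
  obtain D0 where D0: "cover D0" "D0 \<subseteq> F0" "dim D0 < t + c"
    using small_intersection_exists[OF large F0] unfolding cover_def by metis
  obtain M where M: "cover M" and least: "\<And>M'. cover M' \<Longrightarrow> dim M \<le> dim M'"
    using ex_has_least_nat[of cover D0 dim] D0(1) by blast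
  have "t \<le> dim M"
    using M F0 dim_subset[of "F0 \<inter> M" M] unfolding cover_def by force
  then obtain b where b: "dim M = t + b" using le_Suc_ex by blast
  have "b \<ge> 1"
    using no_t_space_met_fully[of M] M b unfolding cover_def by (cases b) auto
  have "t + b \<le> k"
    using least[OF D0(1)] dim_subset[OF D0(2)] member(2)[OF F0] b by simp
  have "1 \<le> c" using D0(3) least[OF D0(1)] b by simp
  let ?B = "num_above CARD('a) (t + b)"
  have B: "?B \<ge> 0" by (rule num_above_nonneg)
  have branch: "real (card {G \<in> \<F>. S \<subseteq> G}) \<le> real CARD('a) ^ (c * i) * ?B"
    if "i \<le> b" "subspace S" "dim S = t + b - i" for i S
    using that
  proof (induction i arbitrary: S)
    case 0
    then show ?case using card_members_containing_le[of S] \<open>t + b \<le> k\<close> by simp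
  next
    case (Suc i)
    have "\<not> cover S" using least[of S] Suc.prems b by force
    then obtain F where F: "F \<in> \<F>" "dim (F \<inter> S) < t"
      using Suc.prems(2) unfolding cover_def by force
    obtain D where D: "subspace D" "D \<subseteq> F" "dim D < t + c" "\<And>G. G \<in> \<F> \<Longrightarrow> t \<le> dim (G \<inter> D)"
      using small_intersection_exists[OF large F(1)] by blast
    have "dim (S \<inter> D) < t" using dim_subset[of "S \<inter> D" "F \<inter> S"] D(2) F(2) by force
    moreover have "real (card {G \<in> {G \<in> \<F>. S \<subseteq> G}. S' \<subseteq> G}) \<le> real CARD('a) ^ (c * i) * ?B"
      if "subspace S'" "dim S' = Suc (dim S)" for S'
    proof -
      have "card {G \<in> {G \<in> \<F>. S \<subseteq> G}. S' \<subseteq> G} \<le> card {G \<in> \<F>. S' \<subseteq> G}"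
        by (intro card_mono finite_vector_sets) auto
      moreover have "dim S' = t + b - i" using that(2) Suc.prems(1,3) by simp
      ultimately show ?thesis using Suc.IH[of S'] Suc.prems(1) that(1) by fastforce
    qed
    \<comment> \<open>Since \<open>dim D \<le> t + (c - 1)\<close>, one branching step costs a factor \<open>q ^ c\<close>.\<close>
    ultimately have "real (card {G \<in> \<F>. S \<subseteq> G})
        \<le> real CARD('a) ^ Suc (c - 1) * (real CARD('a) ^ (c * i) * ?B)"
      using Suc.prems(2) D B member(1) by (intro card_branching_le[of S D t]) auto
    then show ?case using \<open>1 \<le> c\<close> by (simp add: power_add mult_ac)
  qed
  have "real (card \<F>) \<le> real CARD('a) ^ (Suc t * (dim M - t)) * (real CARD('a) ^ (c * b) * ?B)"
    using M member(1) branch[of b] \<open>t \<le> dim M\<close> unfolding cover_def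
    by (intro card_meeting_le) auto
  also have "\<dots> = real CARD('a) ^ (b * (t + Suc c)) * ?B"
    by (simp add: b algebra_simps flip: power_add)
  also have "\<dots> < num_above CARD('a) t"
    using num_above_decay \<open>b \<ge> 1\<close> \<open>t + b \<le> k\<close> by simp
  finally show False using large by simp
qed

end

section \<open>The bound and the extremal families\<close>

theorem theorem1p2:
  fixes scale :: "'a::{field,finite} \<Rightarrow> 'b::ab_group_add \<Rightarrow> 'b"
    and r k t n :: nat
    and \<F> :: "'b set set"
  assumes "vector_space scale"
    and "vector_space.dim scale (UNIV :: 'b set) = n"
    and "r \<ge> 3" and "k \<ge> t" and "t \<ge> 1"
    and "real n \<ge> (real r * real k - real t) / (real r - 1) + real t + 1"
    and "\<F> \<subseteq> vector_space.grassmannian scale k"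
    and "vector_space.wise_intersecting scale r t \<F>"
  shows "real (card \<F>) \<le> gauss_binomial CARD('a) (int n - int t) (int k - int t) \<and>
    (real (card \<F>) = gauss_binomial CARD('a) (int n - int t) (int k - int t) \<longleftrightarrow>
      (\<exists>T \<in> vector_space.grassmannian scale t.
         \<F> = {F \<in> vector_space.grassmannian scale k. T \<subseteq> F}))"
proof -
  define c where "c = n - (k + t + 1)"
  \<comment> \<open>The hypothesis on \<open>n\<close> becomes \<open>n = k + t + c + 1\<close> together with \<open>k - t \<le> (r - 1) c\<close>.\<close>
  have split: "(real r * real k - real t) / (real r - 1) = real k + (real k - real t) / (real r - 1)"
    using assms(3) by (simp add: field_simps)
  moreover have "(real k - real t) / (real r - 1) \<ge> 0"
    using assms(3,4) by simp
  ultimately have "real (k + t + 1) \<le> real n" using assms(6) by simp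
  then have n: "n = k + t + Suc c" unfolding of_nat_le_iff c_def by simp
  have "(real k - real t) / (real r - 1) \<le> real c"
    using assms(6) split n by simp
  then have "real (k - t) \<le> real ((r - 1) * c)"
    using assms(3,4) by (simp add: of_nat_diff field_simps)
  then have kc: "k - t \<le> (r - 1) * c" unfolding of_nat_le_iff .
  obtain Basis where "\<not> module.dependent scale Basis" "UNIV \<subseteq> module.span scale Basis"
    and card_Basis: "card Basis = n"
    using vector_space.basis_exists[OF assms(1), of UNIV] assms(2) by metis
  moreover have "finite Basis" using card_Basis n card_ge_0_finite by force
  ultimately interpret finite_field_vector_space scale Basis
    using assms(1)
    by (auto simp: finite_field_vector_space_def finite_dimensional_vector_space_def
        finite_dimensional_vector_space_axioms_def)
  have dimension: "dimension = n" by (simp add: dimension_def card_Basis)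
  have gauss: "gauss_binomial CARD('a) (int n - int t) (int k - int t)
      = gauss_binomial CARD('a) (int (dimension - t)) (int (k - t))"
    using assms(4) n by (simp add: dimension of_nat_diff)
  have star: "real (card {F \<in> grassmannian k. T \<subseteq> F})
      = gauss_binomial CARD('a) (int n - int t) (int k - int t)" if "T \<in> grassmannian t" for T
    using card_grassmannian_containing[of T k] that assms(4) n
    unfolding gauss dimension by (simp add: grassmannian_def)
  show ?thesis
  proof (cases "\<exists>T \<in> grassmannian t. \<forall>F \<in> \<F>. T \<subseteq> F")
    case True
    then obtain T where T: "T \<in> grassmannian t" and sub: "\<F> \<subseteq> {F \<in> grassmannian k. T \<subseteq> F}"
      using assms(7) by blast
    have "card \<F> \<le> card {F \<in> grassmannian k. T \<subseteq> F}"
      by (intro card_mono finite_vector_sets sub)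
    then have le: "real (card \<F>) \<le> gauss_binomial CARD('a) (int n - int t) (int k - int t)"
      unfolding star[OF T, symmetric] by (rule of_nat_mono)
    have eq: "\<F> = {F \<in> grassmannian k. T \<subseteq> F}"
      if "real (card \<F>) = gauss_binomial CARD('a) (int n - int t) (int k - int t)"
      using that unfolding star[OF T, symmetric] of_nat_eq_iff
      by (intro card_subset_eq finite_vector_sets sub)
    show ?thesis
    proof (intro conjI iffI)
      show "\<exists>T\<in>grassmannian t. \<F> = {F \<in> grassmannian k. T \<subseteq> F}"
        if "real (card \<F>) = gauss_binomial CARD('a) (int n - int t) (int k - int t)"
        using T eq[OF that] by blast
      show "real (card \<F>) = gauss_binomial CARD('a) (int n - int t) (int k - int t)"
        if "\<exists>T\<in>grassmannian t. \<F> = {F \<in> grassmannian k. T \<subseteq> F}"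
        using that star by blast
    qed (rule le)
  next
    case False
    then interpret nontrivial_wise_intersecting_family scale Basis r k t c \<F>
      using assms n kc dimension by unfold_locales auto
    have "real (card \<F>) < gauss_binomial CARD('a) (int n - int t) (int k - int t)"
      unfolding gauss by (rule card_less_of_no_common)
    then show ?thesis using False by auto
  qed
qed

end
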